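(* For every oriented cycle $C$, $\chi(\mathrm{S\text{-}Forb}(C))=+\infty$; that is, for every integer $N$ there is a digraph with chromatic number at least $N$ that contains no subdivision of $C$ as a subdigraph.
   Context: Digraphs are finite, without loops or parallel arcs (two opposite arcs between the same two vertices are allowed). The chromatic number $\chi(D)$ of a digraph $D$ is the chromatic number of its underlying undirected graph. The chromatic number $\chi(\mathcal D)$ of a class $\mathcal D$ of digraphs is the smallest $k$ such that $\chi(D)\le k$ for all $D\in\mathcal D$, or $+\infty$ if no such $k$ exists. An oriented cycle is an orientation of an undirected cycle. A subdivision of a digraph $F$ is obtained from $F$ by replacing each arc $uv$ by a directed $(u,v)$-path of length at least $1$, these paths being pairwise internally disjoint with new internal vertices. $\mathrm{S\text{-}Forb}(F)$ is the class of digraphs containing no subdivision of $F$ as a subdigraph. *)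

theory Defs
  imports "Graph_Theory.Graph_Theory" "HOL-Library.Extended_Nat"
begin

text \<open>
  Digraphs are values of type \<open>'a pair_pre_digraph\<close> satisfying \<^locale>\<open>pair_digraph\<close>: finite,
  loopless, and, the arcs being a set of pairs, without parallel arcs. As usual in
  \<^theory>\<open>Graph_Theory.Graph_Theory\<close>, an undirected graph is a symmetric digraph, and
  \<^const>\<open>mk_symmetric\<close> yields the underlying undirected graph.
\<close>

definition proper_colouring :: "'a pair_pre_digraph \<Rightarrow> nat \<Rightarrow> ('a \<Rightarrow> nat) \<Rightarrow> bool" where
  "proper_colouring G k c \<longleftrightarrow>
     (\<forall>v \<in> pverts G. c v < k) \<and> (\<forall>(u, v) \<in> parcs G. c u \<noteq> c v)"

definition graph_chromatic_number :: "'a pair_pre_digraph \<Rightarrow> nat" where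
  "graph_chromatic_number G = (LEAST k. \<exists>c. proper_colouring G k c)"

definition chromatic_number :: "'a pair_pre_digraph \<Rightarrow> nat" where
  "chromatic_number D = graph_chromatic_number (mk_symmetric (with_proj D))"

definition class_chromatic_number :: "'a pair_pre_digraph set \<Rightarrow> enat" where
  "class_chromatic_number \<D> =
     (if \<exists>k. \<forall>D \<in> \<D>. chromatic_number D \<le> k
      then enat (LEAST k. \<forall>D \<in> \<D>. chromatic_number D \<le> k)
      else \<infinity>)"

text \<open>Undirected graphs are simple, so an undirected cycle has at least three vertices.\<close>

definition undirected_cycle :: "'a pair_pre_digraph \<Rightarrow> bool" where
  "undirected_cycle G \<longleftrightarrow>
     (\<exists>vs. 3 \<le> length vs \<and> distinct vs \<and> pverts G = set vs \<and>
        parcs G = (\<Union>i<length vs. {(vs ! i, vs ! (Suc i mod length vs)),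
                                   (vs ! (Suc i mod length vs), vs ! i)}))"

definition orientation_of :: "'a pair_pre_digraph \<Rightarrow> 'a pair_pre_digraph \<Rightarrow> bool" where
  "orientation_of D G \<longleftrightarrow>
     pair_digraph D \<and> mk_symmetric (with_proj D) = G \<and>
     (\<forall>u v. (u, v) \<in> parcs D \<longrightarrow> (v, u) \<notin> parcs D)"

definition oriented_cycle :: "'a pair_pre_digraph \<Rightarrow> bool" where
  "oriented_cycle C \<longleftrightarrow> (\<exists>G. undirected_cycle G \<and> orientation_of C G)"

text \<open>
  The library's \<^const>\<open>subdivision\<close> only covers bidirected digraphs. Here \<open>S\<close> is a subdivision
  of \<open>F\<close> up to renaming of vertices: \<open>f\<close> gives the copies in \<open>S\<close> of the vertices of \<open>F\<close>, and
  \<open>P a\<close> is the directed path, as a list of arcs, that replaces the arc \<open>a\<close>.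
\<close>

definition is_subdivision :: "'a pair_pre_digraph \<Rightarrow> 'b pair_pre_digraph \<Rightarrow> bool" where
  "is_subdivision F S \<longleftrightarrow>
     (\<exists>(f :: 'a \<Rightarrow> 'b) (P :: 'a \<times> 'a \<Rightarrow> ('b \<times> 'b) awalk).
        inj_on f (pverts F) \<and>
        (\<forall>(u, v) \<in> parcs F. pre_digraph.apath (with_proj S) (f u) (P (u, v)) (f v) \<and>
                           1 \<le> length (P (u, v))) \<and>
        (\<forall>a \<in> parcs F. set (pre_digraph.inner_verts (with_proj S) (P a)) \<inter> f ` pverts F = {}) \<and>
        (\<forall>a \<in> parcs F. \<forall>b \<in> parcs F. a \<noteq> b \<longrightarrow>
           set (pre_digraph.inner_verts (with_proj S) (P a)) \<inter>
           set (pre_digraph.inner_verts (with_proj S) (P b)) = {}) \<and>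
        pverts S = f ` pverts F \<union>
          (\<Union>a \<in> parcs F. set (pre_digraph.inner_verts (with_proj S) (P a))) \<and>
        parcs S = (\<Union>a \<in> parcs F. set (P a)))"

definition contains_subdivision :: "'b pair_pre_digraph \<Rightarrow> 'a pair_pre_digraph \<Rightarrow> bool" where
  "contains_subdivision D F \<longleftrightarrow>
     (\<exists>S. subgraph (with_proj S) (with_proj D) \<and> is_subdivision F S)"

definition S_Forb :: "'a pair_pre_digraph \<Rightarrow> 'b pair_pre_digraph set" where
  "S_Forb F = {D. pair_digraph D \<and> \<not> contains_subdivision D F}"

end

theory Submission
  imports Defs "HOL-Library.FuncSet"
begin

text \<open>
  A digraph is levelled with \<open>N\<close> levels if its vertices carry numbers below \<open>N\<close> that increase along
  every arc. In such a digraph directed paths are short: they have fewer than \<open>N\<close> arcs. So a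
  subdivision of an oriented cycle \<open>C\<close> with \<open>r\<close> arcs that lies in it is, without directions, a cycle
  of length at most \<open>r * N\<close>. If the underlying graph has girth greater than \<open>r * N\<close>, there is no such
  subdivision (\<open>levelled_locally_sparse_no_subdivision\<close>). This covers directed cycles and all other
  orientations alike.

  It remains to find levelled digraphs with \<open>N\<close> levels, chromatic number at least \<open>N\<close> and girth as
  large as desired. Colour a graph of large girth and chromatic number greater than \<open>N\<close> optimally, keep
  \<open>N\<close> colour classes, and direct the edges from smaller to larger colours
  (\<open>levelled_subdigraph_exists\<close>).

  Graphs of large girth and large chromatic number exist by the argument of Erdos
  (\<open>locally_sparse_uncolourable_exists\<close>): a random graph of suitable constant average degree has few
  short cycles and no large independent set, and deleting a vertex from each short cycle leaves a
  graph of large girth in which every independent set is still too small to be a colour class of a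
  colouring with few colours. Girth greater than \<open>L\<close> is expressed by edge counts: every nonempty set
  of at most \<open>L\<close> vertices spans fewer edges than it has vertices.
\<close>

section \<open>Subdivisions in sparse levelled digraphs\<close>

text \<open>
  For a finite digraph without loops and opposite arcs this says that the underlying graph has girth
  greater than \<open>L\<close>: a cycle has as many edges as vertices, while a forest has fewer edges than
  vertices. Counting edges rather than naming cycles suits both the probabilistic estimate and the
  treatment of subdivisions, since no cyclic ordering of the vertices ever has to be exhibited.
\<close>

definition locally_sparse :: "nat \<Rightarrow> 'a pair_pre_digraph \<Rightarrow> bool" where
  "locally_sparse L G \<longleftrightarrow>
     (\<forall>U \<subseteq> pverts G. U \<noteq> {} \<longrightarrow> card U \<le> L \<longrightarrow> card (parcs G \<inter> U \<times> U) < card U)"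

text \<open>
  The list \<open>tl (map fst p)\<close> consists of the inner vertices of \<open>p\<close>: each is the tail of the arc by which
  the path leaves it, and the first arc leaves the start of the path.
\<close>

lemma pcas_arc_ends:
  assumes "pcas u p v" "(x, y) \<in> set p"
  shows "x = u \<or> x \<in> set (tl (map fst p))" and "y = v \<or> y \<in> set (tl (map fst p))"
  using assms
proof (induction p arbitrary: u)
  case (Cons e p)
  case 1 then show ?case by force
next
  case (Cons e p)
  case 2
  show ?case
  proof (cases p)
    case Nil with 2 show ?thesis by auto
  next
    case C: (Cons e' p')
    with 2 Cons(2)[of "snd e"] show ?thesis by auto
  qed
qed auto

text \<open>
  This is where the levels enter: in a digraph with \<open>N\<close> levels that every arc climbs, a directed
  path has fewer than \<open>N\<close> arcs, so that subdividing cannot create arbitrarily long detours.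
\<close>

lemma pcas_level_increase:
  fixes \<phi> :: "'a \<Rightarrow> nat"
  assumes "pcas u p v" and "\<And>x y. (x, y) \<in> set p \<Longrightarrow> \<phi> x < \<phi> y"
  shows "\<phi> u + length p \<le> \<phi> v"
  using assms
proof (induction p arbitrary: u)
  case (Cons e p)
  have "\<phi> (snd e) + length p \<le> \<phi> v" using Cons.prems by (intro Cons.IH) auto
  moreover have "\<phi> (fst e) < \<phi> (snd e)" using Cons.prems(2)[of "fst e" "snd e"] by simp
  ultimately show ?case using Cons.prems(1) by auto
qed auto

lemma distinct_pawalk_verts_imp_distinct:
  assumes "distinct (pawalk_verts u p)"
  shows "distinct p"
proof -
  have *: "fst ` set p \<subseteq> set (pawalk_verts u p)" for u :: 'a and p
    by (induction p arbitrary: u) auto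
  show ?thesis using assms
  proof (induction p arbitrary: u)
    case (Cons e p)
    then have "fst e \<notin> fst ` set p" using *[of p "snd e"] by auto
    then show ?case using Cons by auto
  qed simp
qed

text \<open>
  Replacing an arc by a path with \<open>l\<close> arcs adds \<open>l - 1\<close> vertices and \<open>l - 1\<close> arcs, so a subdivision
  keeps the inequality between the numbers of vertices and arcs. The arc count needs the paths to be
  arc-disjoint: an arc on two of the paths could have no inner vertex of either as an end, hence it
  would run between the same two branch vertices for both, and the two subdivided arcs would agree.
\<close>

lemma subdivision_arcs_bounds:
  fixes F :: "'a pair_pre_digraph" and S :: "'b pair_pre_digraph" and \<phi> :: "'b \<Rightarrow> nat"
  assumes "is_subdivision F S" and "pair_digraph F" and "card (pverts F) \<le> card (parcs F)"
    and up: "\<And>x y. (x, y) \<in> parcs S \<Longrightarrow> \<phi> x < \<phi> y"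
    and lev: "\<And>x. x \<in> pverts S \<Longrightarrow> \<phi> x < N"
  shows "card (pverts S) \<le> card (parcs S)" and "card (parcs S) \<le> card (parcs F) * N"
proof -
  interpret F: pair_digraph F by fact
  let ?iv = "\<lambda>p :: ('b \<times> 'b) list. set (tl (map fst p))"
  obtain f :: "'a \<Rightarrow> 'b" and P :: "'a \<times> 'a \<Rightarrow> ('b \<times> 'b) awalk" where inj: "inj_on f (pverts F)"
    and paths: "\<forall>(u, v) \<in> parcs F. pre_digraph.apath (with_proj S) (f u) (P (u, v)) (f v) \<and>
      1 \<le> length (P (u, v))"
    and branches: "\<forall>a \<in> parcs F. ?iv (P a) \<inter> f ` pverts F = {}"
    and disjs: "\<forall>a \<in> parcs F. \<forall>b \<in> parcs F. a \<noteq> b \<longrightarrow> ?iv (P a) \<inter> ?iv (P b) = {}"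
    and V: "pverts S = f ` pverts F \<union> (\<Union>a \<in> parcs F. ?iv (P a))"
    and A: "parcs S = (\<Union>a \<in> parcs F. set (P a))"
    using assms(1) unfolding is_subdivision_def inner_verts_with_proj_def
    by (elim exE conjE) (rule that)
  have path: "pre_digraph.apath (with_proj S) (f u) (P (u, v)) (f v)"
    and len: "1 \<le> length (P (u, v))" if "(u, v) \<in> parcs F" for u v
    using paths that by auto
  note branch = bspec[OF branches] and disj = disjs[rule_format]
  have cas: "pcas (f u) (P (u, v)) (f v)" and dist: "distinct (P (u, v))"
    if "(u, v) \<in> parcs F" for u v
    using path[OF that] unfolding pre_digraph.apath_def pre_digraph.awalk_def
      cas_with_proj_eq awalk_verts_with_proj_eq
    by (auto intro: distinct_pawalk_verts_imp_distinct)
  have arcs_disjoint: "set (P a) \<inter> set (P b) = {}"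
    if ab: "a \<in> parcs F" "b \<in> parcs F" "a \<noteq> b" for a b
  proof (rule ccontr)
    assume "set (P a) \<inter> set (P b) \<noteq> {}"
    then obtain x y where xy: "(x, y) \<in> set (P a)" "(x, y) \<in> set (P b)" by auto
    obtain u v u' v' where [simp]: "a = (u, v)" "b = (u', v')" by fastforce
    have mem: "u \<in> pverts F" "v \<in> pverts F" "u' \<in> pverts F" "v' \<in> pverts F"
      using ab F.wellformed' by auto
    have "x = f u \<or> x \<in> ?iv (P a)" "y = f v \<or> y \<in> ?iv (P a)"
      using pcas_arc_ends[OF cas] ab xy by auto
    moreover have "x = f u' \<or> x \<in> ?iv (P b)" "y = f v' \<or> y \<in> ?iv (P b)"
      using pcas_arc_ends[OF cas] ab xy by auto
    ultimately have "f u = f u' \<and> f v = f v'"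
      using mem branch[OF ab(1)] branch[OF ab(2)] disj[OF ab] by blast
    then have "a = b" using inj mem by (auto dest: inj_onD)
    with ab show False by simp
  qed
  have finA: "finite (parcs F)" and finV: "finite (pverts F)"
    using F.pair_finite_arcs F.pair_finite_verts by auto
  have cardA: "card (parcs S) = (\<Sum>a\<in>parcs F. length (P a))"
    unfolding A using arcs_disjoint dist finA
    by (subst card_UN_disjoint) (auto intro!: sum.cong simp: distinct_card)
  have iv_le: "card (?iv (P a)) + 1 \<le> length (P a)" if "a \<in> parcs F" for a
    using len[of "fst a" "snd a"] that card_length[of "tl (map fst (P a))"] by auto
  have "card (pverts S) \<le> card (f ` pverts F) + card (\<Union>a \<in> parcs F. ?iv (P a))"
    unfolding V by (rule card_Un_le)
  also have "\<dots> \<le> card (parcs F) + (\<Sum>a\<in>parcs F. card (?iv (P a)))"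
    using card_UN_le[OF finA, of "\<lambda>a. ?iv (P a)"] card_image_le[OF finV, of f] assms(3)
    by linarith
  also have "\<dots> = (\<Sum>a\<in>parcs F. card (?iv (P a)) + 1)"
    by (simp add: sum_Suc)
  also have "\<dots> \<le> card (parcs S)"
    unfolding cardA using iv_le by (intro sum_mono) auto
  finally show "card (pverts S) \<le> card (parcs S)" .
  have "length (P a) \<le> N" if a: "a \<in> parcs F" for a
  proof -
    obtain u v where [simp]: "a = (u, v)" by fastforce
    have "\<phi> (f u) + length (P a) \<le> \<phi> (f v)"
      using a A up by (intro pcas_level_increase) (auto simp: cas)
    moreover have "\<phi> (f v) < N" using a V F.wellformed' by (intro lev) auto
    ultimately show ?thesis by simp
  qed
  then show "card (parcs S) \<le> card (parcs F) * N"
    unfolding cardA using sum_bounded_above[of "parcs F" "\<lambda>a. length (P a)" N] by simp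
qed

text \<open>
  A subdivision of \<open>F\<close> in a digraph with \<open>N\<close> levels has at most \<open>N\<close> arcs for each arc of \<open>F\<close>, and
  therefore at most \<open>card (parcs F) * N\<close> vertices; but it has at least as many arcs as vertices, which
  contradicts sparsity at that scale.
\<close>

lemma levelled_locally_sparse_no_subdivision:
  fixes F :: "'a pair_pre_digraph" and D :: "'b pair_pre_digraph" and \<phi> :: "'b \<Rightarrow> nat"
  assumes F: "pair_digraph F" "pverts F \<noteq> {}" "card (pverts F) \<le> card (parcs F)"
    and D: "pair_digraph D" "locally_sparse (card (parcs F) * N) D"
    and up: "\<And>x y. (x, y) \<in> parcs D \<Longrightarrow> \<phi> x < \<phi> y"
    and lev: "\<And>x. x \<in> pverts D \<Longrightarrow> \<phi> x < N"
  shows "\<not> contains_subdivision D F"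
proof
  assume "contains_subdivision D F"
  then obtain S where sub: "subgraph (with_proj S) (with_proj D)" and S: "is_subdivision F S"
    unfolding contains_subdivision_def by auto
  have VS: "pverts S \<subseteq> pverts D" and AS: "parcs S \<subseteq> parcs D" and "wf_digraph (with_proj S)"
    using sub unfolding subgraph_def by auto
  then interpret S: pair_wf_digraph S by (simp add: wf_digraph_wp_iff)
  interpret D: pair_digraph D by fact
  have le: "card (pverts S) \<le> card (parcs S)" "card (parcs S) \<le> card (parcs F) * N"
    using subdivision_arcs_bounds[OF S F(1,3), of \<phi> N] up lev VS AS by blast+
  have "pverts S \<noteq> {}" using S F(2) unfolding is_subdivision_def by auto
  then have "card (parcs D \<inter> pverts S \<times> pverts S) < card (pverts S)"
    using D(2) VS le unfolding locally_sparse_def by (meson order_trans)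
  moreover have "card (parcs S) \<le> card (parcs D \<inter> pverts S \<times> pverts S)"
    using AS S.wellformed' D.pair_finite_arcs by (intro card_mono) auto
  ultimately show False using le by simp
qed

text \<open>
  The edges joining consecutive vertices of a cycle are pairwise distinct because the cycle has at least
  three vertices, and each of them underlies some arc.
\<close>

lemma oriented_cycle_arcs:
  fixes C :: "'a pair_pre_digraph"
  assumes "oriented_cycle C"
  shows "pair_digraph C" "pverts C \<noteq> {}" "card (pverts C) \<le> card (parcs C)"
proof -
  obtain G where G: "undirected_cycle G" "pair_digraph C" "mk_symmetric (with_proj C) = G"
    using assms unfolding oriented_cycle_def orientation_of_def by auto
  then interpret C: pair_digraph C by simp
  obtain vs where vs: "3 \<le> length vs" "distinct vs" "pverts G = set vs"
    and arcs: "parcs G = (\<Union>i<length vs. {(vs ! i, vs ! (Suc i mod length vs)),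
                                   (vs ! (Suc i mod length vs), vs ! i)})"
    using G(1) unfolding undirected_cycle_def by auto
  have V: "pverts C = set vs" unfolding vs(3)[symmetric] G(3)[symmetric] by simp
  have A: "parcs G = (\<Union>(x, y)\<in>parcs C. {(x, y), (y, x)})"
    unfolding G(3)[symmetric] parcs_mk_symmetric by auto
  let ?n = "length vs"
  let ?edge = "\<lambda>i. {vs ! i, vs ! (Suc i mod ?n)}"
  have inj: "inj_on ?edge {..<?n}"
  proof (rule inj_onI)
    fix i j assume ij: "i \<in> {..<?n}" "j \<in> {..<?n}" "?edge i = ?edge j"
    have lt: "Suc i mod ?n < ?n" "Suc j mod ?n < ?n" using vs(1) by (auto intro: mod_less_divisor)
    have "i = j \<or> (i = Suc j mod ?n \<and> Suc i mod ?n = j)"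
      using ij lt vs(2) by (auto simp: doubleton_eq_iff nth_eq_iff_index_eq)
    \<comment> \<open>In the second case \<open>j\<close> is congruent to \<open>j + 2\<close> modulo \<open>length vs\<close>, which is at least 3.\<close>
    then show "i = j"
      using ij(1,2) vs(1) by (auto simp: mod_Suc split: if_splits)
  qed
  have "?edge ` {..<?n} \<subseteq> (\<lambda>(x, y). {x, y}) ` parcs C"
  proof
    fix e assume "e \<in> ?edge ` {..<?n}"
    then obtain i where i: "i < ?n" "e = ?edge i" by auto
    then have "(vs ! i, vs ! (Suc i mod ?n)) \<in> parcs G" unfolding arcs by blast
    then show "e \<in> (\<lambda>(x, y). {x, y}) ` parcs C" unfolding A i(2)
      by (force simp: insert_commute)
  qed
  then have "card {..<?n} \<le> card ((\<lambda>(x, y). {x, y}) ` parcs C)"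
    unfolding card_image[OF inj, symmetric]
    by (intro card_mono finite_imageI C.pair_finite_arcs)
  also have "\<dots> \<le> card (parcs C)" by (rule card_image_le[OF C.pair_finite_arcs])
  finally show "card (pverts C) \<le> card (parcs C)" using V vs(2) by (simp add: distinct_card)
  show "pair_digraph C" by fact
  show "pverts C \<noteq> {}" using V vs(1) by auto
qed

section \<open>Levelled digraphs from optimal colourings\<close>

lemma proper_colouring_mk_symmetric:
  "proper_colouring (mk_symmetric (with_proj D)) k c \<longleftrightarrow> proper_colouring D k c"
  unfolding proper_colouring_def parcs_mk_symmetric by fastforce

lemma pair_digraph_proper_colouring_exists:
  assumes "pair_digraph D"
  shows "\<exists>k c. proper_colouring D k c"
proof -
  interpret pair_digraph D by fact
  obtain c :: "'a \<Rightarrow> nat" and n where c: "c ` pverts D = {i. i < n}" "inj_on c (pverts D)"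
    using finite_imp_inj_to_nat_seg[OF pair_finite_verts] by auto
  have "c x \<noteq> c y" if "(x, y) \<in> parcs D" for x y
    using inj_onD[OF c(2), of x y] that wellformed' no_loops' by blast
  then have "proper_colouring D n c"
    unfolding proper_colouring_def using c(1) by auto
  then show ?thesis by blast
qed

lemma le_chromatic_numberI:
  assumes "pair_digraph D" and "\<And>k c. proper_colouring D k c \<Longrightarrow> N \<le> k"
  shows "N \<le> chromatic_number D"
proof -
  have "\<exists>c. proper_colouring D (chromatic_number D) c"
    unfolding chromatic_number_def graph_chromatic_number_def proper_colouring_mk_symmetric
    using pair_digraph_proper_colouring_exists[OF assms(1)] by (rule LeastI_ex)
  then show ?thesis using assms(2) by blast
qed

text \<open>
  The sparsity that is needed depends on the number of levels, so this number must not depend on \<open>G\<close>,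
  whose own chromatic number is not controlled from above. In an optimal colouring of \<open>G\<close>, any \<open>N\<close>
  colour classes induce a subgraph that needs \<open>N\<close> colours, for otherwise recolouring them would save a
  colour in \<open>G\<close>. Take the classes of the colours below \<open>N\<close> and direct every edge from the smaller colour
  to the larger one, so that the colours become the levels. The orientation of \<open>G\<close> along the vertex
  order only serves to represent each undirected edge by a single pair.
\<close>

lemma levelled_subdigraph_exists:
  fixes G :: "'a :: linorder pair_pre_digraph"
  assumes "pair_digraph G" and ord: "\<And>x y. (x, y) \<in> parcs G \<Longrightarrow> x < y"
    and sparse: "locally_sparse L G" and not_col: "\<not> (\<exists>c. proper_colouring G N c)"
  obtains D :: "'a pair_pre_digraph" and \<phi> :: "'a \<Rightarrow> nat"
  where "pair_digraph D" "locally_sparse L D" "N \<le> chromatic_number D"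
    "\<And>x y. (x, y) \<in> parcs D \<Longrightarrow> \<phi> x < \<phi> y" "\<And>x. x \<in> pverts D \<Longrightarrow> \<phi> x < N"
proof -
  interpret G: pair_digraph G by fact
  define q where "q = (LEAST q. \<exists>c. proper_colouring G q c)"
  have "\<exists>c. proper_colouring G q c"
    unfolding q_def using pair_digraph_proper_colouring_exists[OF assms(1)] by (rule LeastI_ex)
  then obtain \<phi> where \<phi>: "proper_colouring G q \<phi>" by blast
  have q_le: "q \<le> j" if "proper_colouring G j c" for j c
    unfolding q_def using that by (blast intro: Least_le)
  have "N \<le> q"
  proof (rule ccontr)
    assume "\<not> N \<le> q"
    then have "proper_colouring G N \<phi>" using \<phi> unfolding proper_colouring_def by fastforce
    then show False using not_col by blast
  qed
  define V where "V = {v \<in> pverts G. \<phi> v < N}"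
  define D where "D = \<lparr>pverts = V,
    parcs = {(x, y) \<in> V \<times> V. ((x, y) \<in> parcs G \<or> (y, x) \<in> parcs G) \<and> \<phi> x < \<phi> y}\<rparr>"
  have finV: "finite V" unfolding V_def using G.pair_finite_verts by auto
  have D: "pair_digraph D"
  proof
    show "finite (parcs D)" unfolding D_def
      by (rule finite_subset[of _ "V \<times> V"]) (use finV in auto)
  qed (use finV in \<open>auto simp: D_def\<close>)
  have "locally_sparse L D"
    unfolding locally_sparse_def
  proof (intro allI impI)
    fix U assume U: "U \<subseteq> pverts D" "U \<noteq> {}" "card U \<le> L"
    let ?s = "\<lambda>(x, y). (min x y, max x y)"
    have "card (parcs D \<inter> U \<times> U) \<le> card (parcs G \<inter> U \<times> U)"
    proof (rule card_inj_on_le)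
      show "inj_on ?s (parcs D \<inter> U \<times> U)"
        by (rule inj_onI) (auto simp: D_def min_def max_def split: if_splits)
      show "?s ` (parcs D \<inter> U \<times> U) \<subseteq> parcs G \<inter> U \<times> U"
        using ord by (fastforce simp: D_def min_def max_def)
      show "finite (parcs G \<inter> U \<times> U)" using G.pair_finite_arcs by auto
    qed
    also have "\<dots> < card U" using U sparse unfolding locally_sparse_def D_def V_def by auto
    finally show "card (parcs D \<inter> U \<times> U) < card U" .
  qed
  moreover have "N \<le> chromatic_number D"
  proof (rule le_chromatic_numberI[OF D])
    fix j c assume c: "proper_colouring D j c"
    show "N \<le> j"
    proof (rule ccontr)
      assume "\<not> N \<le> j"
      \<comment> \<open>Replace the \<open>N\<close> colours below \<open>N\<close> by the \<open>j\<close> colours of \<open>c\<close> and shift the others down.\<close>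
      define c' where "c' v = (if \<phi> v < N then c v else \<phi> v - (N - j))" for v
      have cV: "c v < j" if "v \<in> V" for v
        using c that unfolding proper_colouring_def D_def by auto
      have "proper_colouring G (q - (N - j)) c'"
        unfolding proper_colouring_def
      proof (intro conjI ballI, goal_cases)
        case (1 v)
        then have "\<phi> v < q" using \<phi> unfolding proper_colouring_def by auto
        then show ?case using 1 cV[of v] \<open>N \<le> q\<close> \<open>\<not> N \<le> j\<close> unfolding c'_def V_def by auto
      next
        case (2 e)
        obtain x y where [simp]: "e = (x, y)" by fastforce
        have xy: "x \<in> pverts G" "y \<in> pverts G" using 2 G.wellformed' by auto
        have ne: "\<phi> x \<noteq> \<phi> y" using 2 \<phi> unfolding proper_colouring_def by auto
        have "c x \<noteq> c y" if "\<phi> x < N" "\<phi> y < N"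
        proof -
          have "(x, y) \<in> parcs D \<or> (y, x) \<in> parcs D"
            using that xy ne 2 unfolding D_def V_def by auto
          then show ?thesis using c unfolding proper_colouring_def by fastforce
        qed
        then show ?case using xy ne cV[of x] cV[of y] \<open>\<not> N \<le> j\<close>
          unfolding c'_def V_def by auto
      qed
      from q_le[OF this] show False using \<open>N \<le> q\<close> \<open>\<not> N \<le> j\<close> by simp
    qed
  qed
  moreover have "\<phi> x < \<phi> y" if "(x, y) \<in> parcs D" for x y using that by (auto simp: D_def)
  moreover have "\<phi> x < N" if "x \<in> pverts D" for x using that by (auto simp: D_def V_def)
  ultimately show thesis using that D by blast
qed

section \<open>Sparse graphs of large chromatic number\<close>

text \<open>
  The random graph is modelled by counting functions \<open>f \<in> P \<rightarrow>\<^sub>E {..<m}\<close>, where the pair \<open>e\<close> is an edge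
  when \<open>f e = 0\<close>; every pair is then an edge independently with probability \<open>1 / m\<close>. The cases
  \<open>B = {0}\<close> and \<open>B = {1..<m}\<close> below give the probability that all pairs in \<open>F\<close>, or none of them, are edges.
\<close>

lemma card_PiE_prescribed:
  fixes m :: nat
  assumes "finite P" "F \<subseteq> P" "B \<subseteq> {..<m}" "m > 0"
  shows "real (card {f \<in> P \<rightarrow>\<^sub>E {..<m}. \<forall>e\<in>F. f e \<in> B}) =
    real m ^ card P * (real (card B) / real m) ^ card F"
proof -
  have "{f \<in> P \<rightarrow>\<^sub>E {..<m}. \<forall>e\<in>F. f e \<in> B} = (\<Pi>\<^sub>E e\<in>P. if e \<in> F then B else {..<m})"
    using assms(2,3) by (fastforce simp: PiE_iff extensional_def split: if_splits)
  then have "card {f \<in> P \<rightarrow>\<^sub>E {..<m}. \<forall>e\<in>F. f e \<in> B}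
      = (\<Prod>e\<in>P. card (if e \<in> F then B else {..<m}))"
    by (simp add: card_PiE assms(1))
  also have "\<dots> = (\<Prod>e\<in>P - F. m) * (\<Prod>e\<in>F. card B)"
    by (subst prod.subset_diff[OF assms(2,1)]) auto
  finally have "card {f \<in> P \<rightarrow>\<^sub>E {..<m}. \<forall>e\<in>F. f e \<in> B} = m ^ card (P - F) * card B ^ card F"
    by simp
  moreover have "card P = card (P - F) + card F"
    using assms(1,2) by (metis card_Diff_subset card_mono finite_subset le_add_diff_inverse2)
  ultimately show ?thesis using assms(4) by (simp add: power_add power_divide)
qed

definition ordered_pairs :: "nat \<Rightarrow> (nat \<times> nat) set" where
  "ordered_pairs n = {(x, y). x < y \<and> y < n}"

lemma finite_ordered_pairs [simp]: "finite (ordered_pairs n)"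
  by (rule finite_subset[of _ "{..<n} \<times> {..<n}"]) (auto simp: ordered_pairs_def)

lemma card_ordered_pairs_Times:
  assumes "T \<subseteq> {..<n}"
  shows "2 * card (ordered_pairs n \<inter> T \<times> T) + card T = card T * card T"
proof -
  let ?Q = "ordered_pairs n \<inter> T \<times> T"
  have fin: "finite T" using assms finite_subset by blast
  have "T \<times> T = (?Q \<union> prod.swap ` ?Q) \<union> (\<lambda>x. (x, x)) ` T"
  proof (intro equalityI subsetI)
    fix e assume "e \<in> T \<times> T"
    then obtain x y where e: "e = (x, y)" "x \<in> T" "y \<in> T" "x < n" "y < n" using assms by blast
    have "e = prod.swap (y, x)" using e by simp
    then show "e \<in> (?Q \<union> prod.swap ` ?Q) \<union> (\<lambda>x. (x, x)) ` T"
      using e by (cases x y rule: linorder_cases) (auto simp: ordered_pairs_def)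
  qed (auto simp: ordered_pairs_def)
  then have "card (T \<times> T) = card ((?Q \<union> prod.swap ` ?Q) \<union> (\<lambda>x. (x, x)) ` T)" by (rule arg_cong)
  also have "\<dots> = card (?Q \<union> prod.swap ` ?Q) + card ((\<lambda>x. (x, x)) ` T)"
    using fin by (intro card_Un_disjoint finite_UnI finite_imageI finite_Int disjI1
        finite_ordered_pairs) (auto simp: ordered_pairs_def)
  also have "card (?Q \<union> prod.swap ` ?Q) = card ?Q + card (prod.swap ` ?Q)"
    by (intro card_Un_disjoint finite_imageI finite_Int disjI1 finite_ordered_pairs)
      (auto simp: ordered_pairs_def)
  also have "card (prod.swap ` ?Q) = card ?Q" by (intro card_image) simp
  also have "card ((\<lambda>x. (x, x)) ` T) = card T" by (intro card_image) (auto simp: inj_on_def)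
  finally show ?thesis by (simp add: card_cartesian_product)
qed

text \<open>
  The witnesses against sparsity. Recording exactly \<open>card U\<close> of the pairs, rather than all pairs that the
  graph spans in \<open>U\<close>, makes the probability that a witness occurs equal to \<open>(1 / m) ^ card U\<close>.
\<close>

definition dense_spots :: "nat \<Rightarrow> nat \<Rightarrow> (nat set \<times> (nat \<times> nat) set) set" where
  "dense_spots n L = (SIGMA U : {U. U \<subseteq> {..<n} \<and> U \<noteq> {} \<and> card U \<le> L}.
     {F. F \<subseteq> ordered_pairs n \<inter> U \<times> U \<and> card F = card U})"

lemma finite_dense_spots [simp]: "finite (dense_spots n L)"
  unfolding dense_spots_def
proof (rule finite_SigmaI)
  show "finite {U. U \<subseteq> {..<n} \<and> U \<noteq> {} \<and> card U \<le> L}"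
    by (rule finite_subset[of _ "Pow {..<n}"]) auto
  show "finite {F. F \<subseteq> ordered_pairs n \<inter> U \<times> U \<and> card F = card U}" for U
    by (rule finite_subset[of _ "Pow (ordered_pairs n)"]) auto
qed

text \<open>
  A set of \<open>u\<close> vertices can be chosen in at most \<open>n ^ u \<le> (d * m) ^ u\<close> ways, which cancels the factor
  \<open>(1 / m) ^ u\<close> up to \<open>d ^ u\<close>; at most \<open>2 ^ (L * L)\<close> sets of pairs belong to it. Hence the expected number
  of witnesses is bounded independently of \<open>m\<close>, that is, of the number of vertices at a fixed average degree.
\<close>

lemma expected_dense_spots:
  assumes "m > 0" "d > 0" "n \<le> d * m"
  shows "(\<Sum>b\<in>dense_spots n L. (1 / real m) ^ card (snd b)) \<le> real (L * d ^ L * 2 ^ (L * L))"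
proof -
  define \<U> where "\<U> = {U :: nat set. U \<subseteq> {..<n} \<and> U \<noteq> {} \<and> card U \<le> L}"
  define \<F> where "\<F> U = {F. F \<subseteq> ordered_pairs n \<inter> U \<times> U \<and> card F = card U}" for U
  have fin\<U>: "finite \<U>" unfolding \<U>_def by (rule finite_subset[of _ "Pow {..<n}"]) auto
  have fin\<F>: "finite (\<F> U)" for U
    unfolding \<F>_def by (rule finite_subset[of _ "Pow (ordered_pairs n)"]) auto
  have finU: "finite U" if "U \<in> \<U>" for U using that finite_subset unfolding \<U>_def by blast
  have "(\<Sum>b\<in>dense_spots n L. (1 / real m) ^ card (snd b)) =
      (\<Sum>U\<in>\<U>. \<Sum>F\<in>\<F> U. (1 / real m) ^ card F)"
    unfolding dense_spots_def \<U>_def[symmetric] \<F>_def[symmetric]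
    using fin\<U> fin\<F> by (simp add: sum.Sigma case_prod_unfold)
  also have "\<dots> = (\<Sum>U\<in>\<U>. real (card (\<F> U)) * (1 / real m) ^ card U)"
    by (intro sum.cong refl) (simp add: \<F>_def)
  also have "\<dots> \<le> (\<Sum>U\<in>\<U>. 2 ^ (L * L) * (1 / real m) ^ card U)"
  proof (intro sum_mono mult_right_mono)
    fix U assume U: "U \<in> \<U>"
    have "card (\<F> U) \<le> card (Pow (U \<times> U))"
      by (intro card_mono) (use finU[OF U] in \<open>auto simp: \<F>_def\<close>)
    also have "\<dots> = 2 ^ (card U * card U)"
      using finU[OF U] by (simp add: card_Pow card_cartesian_product)
    also have "\<dots> \<le> 2 ^ (L * L)"
      using U by (intro power_increasing mult_le_mono) (auto simp: \<U>_def)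
    finally show "real (card (\<F> U)) \<le> 2 ^ (L * L)" by (simp flip: of_nat_le_iff)
  qed auto
  also have "\<dots> = 2 ^ (L * L) * (\<Sum>U\<in>\<U>. (1 / real m) ^ card U)" by (simp add: sum_distrib_left)
  also have "(\<Sum>U\<in>\<U>. (1 / real m) ^ card U) =
      (\<Sum>u\<in>{1..L}. \<Sum>U\<in>{U \<in> \<U>. card U = u}. (1 / real m) ^ card U)"
  proof (rule sum.group[symmetric, OF fin\<U>])
    show "card ` \<U> \<subseteq> {1..L}"
    proof
      fix u assume "u \<in> card ` \<U>"
      then obtain U where U: "U \<in> \<U>" "u = card U" by blast
      then have "U \<noteq> {}" "card U \<le> L" by (simp_all add: \<U>_def)
      then show "u \<in> {1..L}" using finU[OF U(1)] U(2) by (simp add: Suc_le_eq card_gt_0_iff)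
    qed
  qed simp
  also have "\<dots> \<le> (\<Sum>u\<in>{1..L}. real d ^ L)"
  proof (intro sum_mono)
    fix u assume u: "u \<in> {1..L}"
    have "{U \<in> \<U>. card U = u} = {U. U \<subseteq> {..<n} \<and> card U = u}"
      using u by (auto simp: \<U>_def)
    then have "card {U \<in> \<U>. card U = u} = n choose u" by (simp add: n_subsets)
    also have "\<dots> \<le> n ^ u" by (cases "u \<le> n") (auto simp: binomial_le_pow binomial_eq_0)
    also have "\<dots> \<le> (d * m) ^ u" using assms(3) by (rule power_mono) simp
    finally have "real (card {U \<in> \<U>. card U = u}) \<le> real ((d * m) ^ u)" by (simp only: of_nat_le_iff)
    then have "(\<Sum>U\<in>{U \<in> \<U>. card U = u}. (1 / real m) ^ card U) \<le>
        real ((d * m) ^ u) * (1 / real m) ^ u"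
      by (simp add: mult_right_mono)
    also have "\<dots> = real d ^ u" using assms(1) by (simp add: power_mult_distrib power_divide)
    also have "\<dots> \<le> real d ^ L" using u assms(2) by (intro power_increasing) auto
    finally show "(\<Sum>U\<in>{U \<in> \<U>. card U = u}. (1 / real m) ^ card U) \<le> real d ^ L" .
  qed
  finally show ?thesis by (simp add: mult_ac)
qed

lemma one_minus_inverse_power_le:
  assumes "m > 0" "m * j \<le> N"
  shows "(1 - 1 / real m) ^ N \<le> (1 / 2) ^ j"
proof -
  have nonneg: "0 \<le> 1 - 1 / real m" using assms(1) by simp
  have "(1 - 1 / real m) ^ m \<le> exp (- (1 / real m)) ^ m"
    using exp_ge_add_one_self[of "- (1 / real m)"] nonneg by (intro power_mono) auto
  also have "\<dots> = 1 / exp 1"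
    using assms(1) by (simp add: exp_of_nat_mult[symmetric] exp_minus field_simps)
  also have "\<dots> \<le> 1 / 2" using exp_ge_add_one_self[of 1] by (intro divide_left_mono) auto
  finally have half: "(1 - 1 / real m) ^ m \<le> 1 / 2" .
  have "(1 - 1 / real m) ^ N \<le> (1 - 1 / real m) ^ (m * j)"
    using nonneg assms by (intro power_decreasing) auto
  also have "\<dots> \<le> (1 / 2) ^ j"
    unfolding power_mult using half nonneg by (intro power_mono) auto
  finally show ?thesis .
qed

text \<open>
  The first moment method. Let \<open>X f\<close> count the dense spots of the graph given by \<open>f\<close> and \<open>Y f\<close> its
  independent sets of size \<open>s\<close>. If \<open>B\<close> bounds the mean of \<open>X\<close>, then \<open>X f / (2 * B) + Y f\<close> has mean at most
  \<open>1 / 2 + 1 / 4\<close>, so some \<open>f\<close> makes it less than 1. For the mean of \<open>Y\<close>, there are at most \<open>2 ^ n\<close> sets,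
  and the numerical hypothesis on \<open>s\<close> says that each spans at least \<open>m * (n + 2)\<close> pairs, so that each is
  independent with probability at most \<open>(1 / 2) ^ (n + 2)\<close>.
\<close>

lemma few_dense_spots_no_independent_set:
  assumes "m > 0" "d > 0" "L > 0" "n \<le> d * m" "2 * (m * (n + 2)) + s \<le> s * s"
  obtains E where "E \<subseteq> ordered_pairs n"
    "card {b \<in> dense_spots n L. snd b \<subseteq> E} < 2 * (L * d ^ L * 2 ^ (L * L))"
    "\<And>T. T \<subseteq> {..<n} \<Longrightarrow> card T = s \<Longrightarrow> E \<inter> T \<times> T \<noteq> {}"
proof -
  define P where "P = ordered_pairs n"
  define \<Omega> where "\<Omega> = P \<rightarrow>\<^sub>E {..<m}"
  define \<T> where "\<T> = {T. T \<subseteq> {..<n} \<and> card T = s}"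
  define X where "X f = card {b \<in> dense_spots n L. \<forall>e\<in>snd b. f e \<in> {0}}" for f :: "nat \<times> nat \<Rightarrow> nat"
  define Y where "Y f = card {T \<in> \<T>. \<forall>e\<in>P \<inter> T \<times> T. f e \<in> {1..<m}}" for f :: "nat \<times> nat \<Rightarrow> nat"
  define B where "B = L * d ^ L * 2 ^ (L * L)"
  have finP: "finite P" by (simp add: P_def)
  have fin\<Omega>: "finite \<Omega>" unfolding \<Omega>_def using finP by (intro finite_PiE) auto
  have fin\<T>: "finite \<T>" unfolding \<T>_def by (rule finite_subset[of _ "Pow {..<n}"]) auto
  have "B > 0" unfolding B_def using assms by simp
  have card\<Omega>: "card \<Omega> = m ^ card P" unfolding \<Omega>_def using finP by (simp add: card_PiE)
  have "(\<Sum>f\<in>\<Omega>. real (X f)) =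
      real (\<Sum>b\<in>dense_spots n L. card {f \<in> \<Omega>. \<forall>e\<in>snd b. f e \<in> {0}})"
    unfolding X_def of_nat_sum[symmetric]
    by (intro arg_cong[where f = real] sum_multicount_gen) (use fin\<Omega> in auto)
  also have "\<dots> = (\<Sum>b\<in>dense_spots n L. real m ^ card P * (1 / real m) ^ card (snd b))"
    unfolding of_nat_sum
  proof (intro sum.cong refl)
    fix b assume "b \<in> dense_spots n L"
    then have "snd b \<subseteq> P" by (auto simp: dense_spots_def P_def)
    from card_PiE_prescribed[OF finP this, of "{0}" m]
    show "real (card {f \<in> \<Omega>. \<forall>e\<in>snd b. f e \<in> {0}}) = real m ^ card P * (1 / real m) ^ card (snd b)"
      using assms(1) unfolding \<Omega>_def by simp
  qed
  also have "\<dots> \<le> real m ^ card P * real B"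
    unfolding sum_distrib_left[symmetric] B_def
    using expected_dense_spots[OF assms(1,2,4)] by (intro mult_left_mono) auto
  finally have X: "(\<Sum>f\<in>\<Omega>. real (X f)) \<le> real m ^ card P * real B" .
  have "(\<Sum>f\<in>\<Omega>. real (Y f)) =
      real (\<Sum>T\<in>\<T>. card {f \<in> \<Omega>. \<forall>e\<in>P \<inter> T \<times> T. f e \<in> {1..<m}})"
    unfolding Y_def of_nat_sum[symmetric]
    by (intro arg_cong[where f = real] sum_multicount_gen) (use fin\<Omega> fin\<T> in auto)
  also have "\<dots> \<le> (\<Sum>T\<in>\<T>. real m ^ card P * (1 / 2) ^ (n + 2))"
    unfolding of_nat_sum
  proof (intro sum_mono)
    fix T assume T: "T \<in> \<T>"
    have "real (card {f \<in> \<Omega>. \<forall>e\<in>P \<inter> T \<times> T. f e \<in> {1..<m}}) =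
        real m ^ card P * (real (card {1..<m}) / real m) ^ card (P \<inter> T \<times> T)"
      unfolding \<Omega>_def by (intro card_PiE_prescribed finP assms(1)) auto
    also have "real (card {1..<m}) / real m = 1 - 1 / real m"
      using assms(1) by (simp add: of_nat_diff field_simps)
    also have "(1 - 1 / real m) ^ card (P \<inter> T \<times> T) \<le> (1 / 2) ^ (n + 2)"
      using card_ordered_pairs_Times[of T n] T assms(5)
      by (intro one_minus_inverse_power_le assms(1)) (auto simp: \<T>_def P_def)
    finally show "real (card {f \<in> \<Omega>. \<forall>e\<in>P \<inter> T \<times> T. f e \<in> {1..<m}}) \<le>
        real m ^ card P * (1 / 2) ^ (n + 2)" by (simp add: mult_left_mono)
  qed
  also have "\<dots> \<le> 2 ^ n * (real m ^ card P * (1 / 2) ^ (n + 2))"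
  proof -
    have "card \<T> \<le> 2 ^ n" unfolding \<T>_def by (simp add: n_subsets binomial_le_pow2)
    then have "real (card \<T>) \<le> 2 ^ n" by (simp flip: of_nat_le_iff)
    then show ?thesis by (simp add: mult_right_mono)
  qed
  also have "\<dots> = real m ^ card P / 4" by (simp add: power_add power_divide)
  finally have Y: "(\<Sum>f\<in>\<Omega>. real (Y f)) \<le> real m ^ card P / 4" .
  have "\<exists>f\<in>\<Omega>. real (X f) / (2 * real B) + real (Y f) < 1"
  proof (rule ccontr)
    assume "\<not> ?thesis"
    then have "(\<Sum>f\<in>\<Omega>. 1) \<le> (\<Sum>f\<in>\<Omega>. real (X f) / (2 * real B) + real (Y f))"
      by (intro sum_mono) (auto simp: not_less)
    also have "\<dots> = (\<Sum>f\<in>\<Omega>. real (X f)) / (2 * real B) + (\<Sum>f\<in>\<Omega>. real (Y f))"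
      by (simp add: sum.distrib sum_divide_distrib)
    also have "\<dots> \<le> real m ^ card P * real B / (2 * real B) + real m ^ card P / 4"
      using X Y \<open>B > 0\<close> by (intro add_mono divide_right_mono) auto
    also have "\<dots> < real m ^ card P" using \<open>B > 0\<close> assms(1) by simp
    finally show False by (simp add: card\<Omega>)
  qed
  then obtain f where f: "f \<in> \<Omega>" and lt: "real (X f) / (2 * real B) + real (Y f) < 1" by blast
  have "real (X f) / (2 * real B) \<ge> 0" by simp
  then have "real (Y f) < 1" "real (X f) / (2 * real B) < 1" using lt by linarith+
  then have XY: "X f < 2 * B" "Y f = 0" using \<open>B > 0\<close> by (simp_all add: divide_less_eq flip: of_nat_less_iff)
  show thesis
  proof (rule that)
    let ?E = "{e \<in> P. f e = 0}"
    show "?E \<subseteq> ordered_pairs n" by (auto simp: P_def)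
    have "{b \<in> dense_spots n L. snd b \<subseteq> ?E} = {b \<in> dense_spots n L. \<forall>e\<in>snd b. f e \<in> {0}}"
      by (auto simp: dense_spots_def P_def)
    then show "card {b \<in> dense_spots n L. snd b \<subseteq> ?E} < 2 * (L * d ^ L * 2 ^ (L * L))"
      using XY(1) unfolding X_def B_def by simp
    fix T assume T: "T \<subseteq> {..<n}" "card T = s"
    have "{T \<in> \<T>. \<forall>e\<in>P \<inter> T \<times> T. f e \<in> {1..<m}} = {}"
      using XY(2) fin\<T> unfolding Y_def by simp
    then obtain e where e: "e \<in> P \<inter> T \<times> T" "f e \<notin> {1..<m}" using T unfolding \<T>_def by blast
    moreover have "f e < m" using f e(1) unfolding \<Omega>_def by (auto simp: PiE_iff)
    ultimately show "?E \<inter> T \<times> T \<noteq> {}" by auto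
  qed
qed

text \<open>
  The Erdos theorem on graphs of large girth and large chromatic number, by alteration: deleting a vertex
  from each of the fewer than \<open>q\<close> dense spots leaves more than half of the \<open>n = 2 * k * s\<close> vertices, and
  one class of a colouring of them with \<open>k\<close> colours would contain an independent set of size \<open>s\<close>.
\<close>

lemma locally_sparse_uncolourable_exists:
  assumes "L > 0" "k > 0"
  obtains G :: "nat pair_pre_digraph"
  where "pair_digraph G" "\<And>x y. (x, y) \<in> parcs G \<Longrightarrow> x < y" "locally_sparse L G"
    "\<not> (\<exists>c. proper_colouring G k c)"
proof -
  \<comment> \<open>The average degree is of order \<open>d\<close>. An \<open>s\<close>-set spans about \<open>s\<^sup>2 / 2\<close> pairs, which has to exceed
    \<open>m * n\<close>; as \<open>m * n = 4 * k\<^sup>2 * s\<^sup>2 / d\<close>, any \<open>d\<close> well above \<open>8 * k\<^sup>2\<close> does. With \<open>d\<close> fixed, \<open>q\<close> is a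
    constant and \<open>n\<close> is made large compared to it.\<close>
  define d where "d = 16 * (k * k)"
  define q where "q = 2 * (L * d ^ L * 2 ^ (L * L))"
  define s where "s = d * q"
  define m where "m = 2 * k * q"
  define n where "n = 2 * (k * s)"
  have pos: "d > 0" "q > 0" "m > 0" using assms unfolding d_def q_def m_def by auto
  have nd: "n \<le> d * m" unfolding n_def m_def s_def by simp
  have "8 * k + d \<le> 8 * (k * k) * (d * q)"
  proof -
    have "k * 1 \<le> k * k" using assms by (intro mult_le_mono) auto
    then have "8 * k + d \<le> 8 * d" unfolding d_def by simp
    also have "\<dots> \<le> 8 * (k * k) * (d * q)"
      using mult_le_mono[of "8 * 1" "8 * (k * k)" "d * 1" "d * q"] assms(2) pos by simp
    finally show ?thesis .
  qed
  then have "8 * (k * k) * (d * q) + 8 * k + d \<le> d * (d * q)"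
    by (simp add: d_def)
  then have "q * (8 * (k * k) * (d * q) + 8 * k + d) \<le> q * (d * (d * q))" by (rule mult_le_mono2)
  then have "2 * (m * (n + 2)) + s \<le> s * s"
    unfolding m_def n_def s_def by (simp add: algebra_simps)
  then obtain E where E: "E \<subseteq> ordered_pairs n"
    and few: "card {b \<in> dense_spots n L. snd b \<subseteq> E} < q"
    and ind: "\<And>T. T \<subseteq> {..<n} \<Longrightarrow> card T = s \<Longrightarrow> E \<inter> T \<times> T \<noteq> {}"
    unfolding q_def by (rule few_dense_spots_no_independent_set[OF pos(3,1) assms(1) nd]) blast
  define W where "W = (\<lambda>b. SOME x. x \<in> fst b) ` {b \<in> dense_spots n L. snd b \<subseteq> E}"
  have "card W < q" unfolding W_def by (rule le_less_trans[OF card_image_le few]) simp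
  also have "q \<le> k * s" using assms(2) pos unfolding s_def by simp
  finally have cardW: "card W < k * s" .
  define V where "V = {..<n} - W"
  have "finite W" unfolding W_def by simp
  then have "n \<le> card V + card W" unfolding V_def
    using diff_card_le_card_Diff[of W "{..<n}"] by simp
  then have cardV: "k * s < card V" using cardW unfolding n_def by simp
  have finV: "finite V" unfolding V_def by simp
  define G where "G = \<lparr>pverts = V, parcs = E \<inter> V \<times> V\<rparr>"
  show thesis
  proof (rule that)
    show "pair_digraph G"
    proof
      show "finite (parcs G)" using finV by (simp add: G_def)
      show "fst e \<noteq> snd e" if "e \<in> parcs G" for e
        using that E by (auto simp: G_def ordered_pairs_def)
    qed (use finV in \<open>auto simp: G_def\<close>)
    show "x < y" if "(x, y) \<in> parcs G" for x y
      using that E by (auto simp: G_def ordered_pairs_def)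
    show "locally_sparse L G"
      unfolding locally_sparse_def
    proof (intro allI impI, rule ccontr)
      fix U assume U: "U \<subseteq> pverts G" "U \<noteq> {}" "card U \<le> L"
        and "\<not> card (parcs G \<inter> U \<times> U) < card U"
      then obtain F where F: "F \<subseteq> parcs G \<inter> U \<times> U" "card F = card U"
        using obtain_subset_with_card_n[of "card U"] by (metis not_less)
      have "(U, F) \<in> {b \<in> dense_spots n L. snd b \<subseteq> E}"
        using U F E by (auto simp: dense_spots_def G_def V_def)
      then have "(SOME x. x \<in> U) \<in> W" unfolding W_def by (intro image_eqI[of _ _ "(U, F)"]) auto
      moreover have "(SOME x. x \<in> U) \<in> U" using U(2) by (simp add: some_in_eq)
      ultimately show False using U(1) by (auto simp: G_def V_def)
    qed
    show "\<not> (\<exists>c. proper_colouring G k c)"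
    proof
      assume "\<exists>c. proper_colouring G k c"
      then obtain c where c: "proper_colouring G k c" ..
      then have "c \<in> V \<rightarrow> {..<k}" by (auto simp: proper_colouring_def G_def)
      then obtain j where "card V \<le> card (c -` {j} \<inter> V) * k"
        using pigeonhole_card[of c V "{..<k}"] finV assms(2) by auto
      with cardV have "s \<le> card (c -` {j} \<inter> V)"
        by (metis less_le_trans mult.commute mult_less_cancel2 nat_less_le)
      then obtain T where T: "T \<subseteq> c -` {j} \<inter> V" "card T = s"
        using obtain_subset_with_card_n by metis
      then have "E \<inter> T \<times> T \<noteq> {}" by (intro ind) (auto simp: V_def)
      then obtain x y where "(x, y) \<in> E \<inter> T \<times> T" by auto
      then have "(x, y) \<in> parcs G" "c x = c y" using T by (auto simp: G_def)
      then show False using c by (auto simp: proper_colouring_def)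
    qed
  qed
qed

section \<open>Subdivisions of oriented cycles\<close>

theorem theorem7:
  fixes C :: "'a pair_pre_digraph"
  assumes "oriented_cycle C"
  shows "class_chromatic_number (S_Forb C :: nat pair_pre_digraph set) = \<infinity> \<and>
    (\<forall>N :: int. \<exists>D :: nat pair_pre_digraph.
       pair_digraph D \<and> int (chromatic_number D) \<ge> N \<and> \<not> contains_subdivision D C)"
proof -
  note C = oriented_cycle_arcs[OF assms]
  have ex: "\<exists>D :: nat pair_pre_digraph.
      pair_digraph D \<and> N \<le> chromatic_number D \<and> \<not> contains_subdivision D C"
    if N: "N > 0" for N
  proof -
    interpret C: pair_digraph C by (rule C(1))
    have "0 < card (pverts C)" using C(2) C.pair_finite_verts by (simp add: card_gt_0_iff)
    then have "card (parcs C) * N > 0" using C(3) N by simp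
    then obtain G :: "nat pair_pre_digraph" where G: "pair_digraph G"
      "\<And>x y. (x, y) \<in> parcs G \<Longrightarrow> x < y" "locally_sparse (card (parcs C) * N) G"
      "\<not> (\<exists>c. proper_colouring G N c)"
      by (rule locally_sparse_uncolourable_exists[OF _ N]) blast
    obtain D :: "nat pair_pre_digraph" and \<phi> :: "nat \<Rightarrow> nat"
      where D: "pair_digraph D" "locally_sparse (card (parcs C) * N) D" "N \<le> chromatic_number D"
        "\<And>x y. (x, y) \<in> parcs D \<Longrightarrow> \<phi> x < \<phi> y" "\<And>x. x \<in> pverts D \<Longrightarrow> \<phi> x < N"
      by (rule levelled_subdigraph_exists[OF G]) blast+
    have "\<not> contains_subdivision D C"
      by (rule levelled_locally_sparse_no_subdivision[OF C D(1,2,4,5)])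
    then show ?thesis using D(1,3) by blast
  qed
  have "\<nexists>k. \<forall>D \<in> (S_Forb C :: nat pair_pre_digraph set). chromatic_number D \<le> k"
  proof
    assume "\<exists>k. \<forall>D \<in> (S_Forb C :: nat pair_pre_digraph set). chromatic_number D \<le> k"
    then obtain k where k: "\<forall>D \<in> (S_Forb C :: nat pair_pre_digraph set). chromatic_number D \<le> k" ..
    obtain D :: "nat pair_pre_digraph" where "D \<in> S_Forb C" "Suc k \<le> chromatic_number D"
      using ex[of "Suc k"] unfolding S_Forb_def by auto
    then show False using k by fastforce
  qed
  then have "class_chromatic_number (S_Forb C :: nat pair_pre_digraph set) = \<infinity>"
    unfolding class_chromatic_number_def by simp
  moreover have "\<exists>D :: nat pair_pre_digraph.
      pair_digraph D \<and> int (chromatic_number D) \<ge> N \<and> \<not> contains_subdivision D C" for N :: int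
  proof -
    obtain D :: "nat pair_pre_digraph" where
      "pair_digraph D" "Suc (nat N) \<le> chromatic_number D" "\<not> contains_subdivision D C"
      using ex[of "Suc (nat N)"] by auto
    then show ?thesis by (intro exI[of _ D]) auto
  qed
  ultimately show ?thesis by blast
qed

end
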